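(* Let $G$ be an infinite $\sigma$-compact pro-Lie group. Then $G$ has a quotient group which is an infinite separable metrizable group.
   Context: All topological groups are assumed to be Hausdorff. A quotient group of a topological group $G$ means $G/N$ with the quotient topology, where $N$ is a closed normal subgroup of $G$ (the case $N=\{e\}$ is allowed). A Lie group is a real finite-dimensional Lie group; the $0$-dimensional Lie groups are exactly the discrete groups (no countability assumption is made on the number of components). A topological group $G$ is a pro-Lie group if it is complete and every neighborhood of the identity contains a closed normal subgroup $N$ such that $G/N$ is a Lie group. A topological group is $\sigma$-compact if it is a union of countably many compact subsets. *)

theory Defs
  imports "HOL-Analysis.Analysis" "HOL-Algebra.Coset"
begin

section \<open>Topological groups and their quotients\<close>

definition topological_group :: "('a, 'b) monoid_scheme \<Rightarrow> 'a topology \<Rightarrow> bool" where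
  "topological_group G T \<longleftrightarrow>
     group G \<and> topspace T = carrier G \<and> Hausdorff_space T \<and>
     continuous_map (prod_topology T T) T (\<lambda>(x, y). x \<otimes>\<^bsub>G\<^esub> y) \<and>
     continuous_map T T (\<lambda>x. inv\<^bsub>G\<^esub> x)"

definition quotient_topology ::
    "('a, 'b) monoid_scheme \<Rightarrow> 'a topology \<Rightarrow> 'a set \<Rightarrow> 'a set topology" where
  "quotient_topology G T N =
     topology (\<lambda>S. S \<subseteq> carrier (G Mod N) \<and> openin T {x \<in> carrier G. N #>\<^bsub>G\<^esub> x \<in> S})"

lemma openin_quotient_topology:
  "openin (quotient_topology G T N) S \<longleftrightarrow>
     S \<subseteq> carrier (G Mod N) \<and> openin T {x \<in> carrier G. N #>\<^bsub>G\<^esub> x \<in> S}"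
proof -
  let ?P = "\<lambda>S. {x \<in> carrier G. N #>\<^bsub>G\<^esub> x \<in> S}"
  have int: "?P (A \<inter> B) = ?P A \<inter> ?P B" for A B by auto
  have un: "?P (\<Union>\<K>) = \<Union> (?P ` \<K>)" for \<K> by auto
  have "istopology (\<lambda>S. S \<subseteq> carrier (G Mod N) \<and> openin T (?P S))"
    unfolding istopology_def int un by (blast intro: openin_Int openin_Union)
  then show ?thesis
    by (simp add: quotient_topology_def topology_inverse')
qed

lemma quotient_map_quotient_topology:
  assumes "topspace T = carrier G"
  shows "quotient_map T (quotient_topology G T N) (\<lambda>x. N #>\<^bsub>G\<^esub> x)"
proof -
  have car: "carrier (G Mod N) = (\<lambda>x. N #>\<^bsub>G\<^esub> x) ` carrier G"
    by (auto simp: FactGroup_def RCOSETS_def)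
  have all: "{x \<in> carrier G. N #>\<^bsub>G\<^esub> x \<in> carrier (G Mod N)} = topspace T"
    using assms by (auto simp: car)
  have "topspace (quotient_topology G T N) = carrier (G Mod N)"
  proof (rule subset_antisym)
    show "topspace (quotient_topology G T N) \<subseteq> carrier (G Mod N)"
      using openin_quotient_topology openin_topspace by blast
    show "carrier (G Mod N) \<subseteq> topspace (quotient_topology G T N)"
      by (rule openin_subset) (simp only: openin_quotient_topology all openin_topspace subset_refl)
  qed
  then show ?thesis
    using assms by (simp add: quotient_map_def openin_quotient_topology car)
qed

definition sigma_compact_space :: "'a topology \<Rightarrow> bool" where
  "sigma_compact_space T \<longleftrightarrow>
     (\<exists>K :: nat \<Rightarrow> 'a set. (\<forall>i. compactin T (K i)) \<and> topspace T = (\<Union>i. K i))"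

text \<open>
  Cauchy filters are taken with respect to the two-sided uniformity. Completeness in this sense is
  implied by completeness with respect to the left (equivalently, the right) uniformity, and it is
  equivalent to it for groups in which every neighbourhood of the identity contains a closed normal
  subgroup with a Lie quotient.
\<close>

definition group_Cauchy_filter ::
    "('a, 'b) monoid_scheme \<Rightarrow> 'a topology \<Rightarrow> 'a filter \<Rightarrow> bool" where
  "group_Cauchy_filter G T F \<longleftrightarrow>
     F \<noteq> bot \<and> eventually (\<lambda>x. x \<in> carrier G) F \<and>
     (\<forall>U. openin T U \<and> \<one>\<^bsub>G\<^esub> \<in> U \<longrightarrow>
        (\<exists>A \<subseteq> carrier G. eventually (\<lambda>x. x \<in> A) F \<and>
           (\<forall>x\<in>A. \<forall>y\<in>A. inv\<^bsub>G\<^esub> x \<otimes>\<^bsub>G\<^esub> y \<in> U \<and> x \<otimes>\<^bsub>G\<^esub> inv\<^bsub>G\<^esub> y \<in> U)))"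

definition complete_group :: "('a, 'b) monoid_scheme \<Rightarrow> 'a topology \<Rightarrow> bool" where
  "complete_group G T \<longleftrightarrow>
     (\<forall>F. group_Cauchy_filter G T F \<longrightarrow> (\<exists>l. limitin T (\<lambda>x. x) l F))"


section \<open>Smooth maps between open subsets of Euclidean spaces\<close>

text \<open>
  The points of \<^term>\<open>Euclidean_space n\<close> are the functions \<^typ>\<open>nat \<Rightarrow> real\<close> vanishing at all
  \<open>i \<ge> n\<close>; this keeps the dimension a natural number that can be quantified over.
  The set \<open>S\<close> below is meant to be open in \<^term>\<open>Euclidean_space n\<close>, and \<open>g\<close> is the
  \<open>i\<close>-th partial derivative of \<open>f\<close>.
\<close>

primrec Ck_on :: "nat \<Rightarrow> nat \<Rightarrow> (nat \<Rightarrow> real) set \<Rightarrow> ((nat \<Rightarrow> real) \<Rightarrow> real) \<Rightarrow> bool" where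
  "Ck_on 0 n S f \<longleftrightarrow> continuous_map (subtopology (Euclidean_space n) S) euclideanreal f"
| "Ck_on (Suc k) n S f \<longleftrightarrow>
     continuous_map (subtopology (Euclidean_space n) S) euclideanreal f \<and>
     (\<forall>i<n. \<exists>g. Ck_on k n S g \<and>
        (\<forall>x\<in>S. ((\<lambda>t. f (x(i := t))) has_real_derivative g x) (at (x i))))"

definition smooth_map_on ::
    "nat \<Rightarrow> nat \<Rightarrow> (nat \<Rightarrow> real) set \<Rightarrow> ((nat \<Rightarrow> real) \<Rightarrow> nat \<Rightarrow> real) \<Rightarrow> bool" where
  "smooth_map_on n m S f \<longleftrightarrow> (\<forall>j<m. \<forall>k. Ck_on k n S (\<lambda>x. f x j))"


section \<open>Lie groups and pro-Lie groups\<close>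

definition chart :: "'a topology \<Rightarrow> nat \<Rightarrow> 'a set \<Rightarrow> ('a \<Rightarrow> nat \<Rightarrow> real) \<Rightarrow> bool" where
  "chart T n U \<phi> \<longleftrightarrow>
     openin T U \<and> openin (Euclidean_space n) (\<phi> ` U) \<and>
     homeomorphic_map (subtopology T U) (subtopology (Euclidean_space n) (\<phi> ` U)) \<phi>"

definition smooth_atlas ::
    "'a topology \<Rightarrow> nat \<Rightarrow> ('a set \<times> ('a \<Rightarrow> nat \<Rightarrow> real)) set \<Rightarrow> bool" where
  "smooth_atlas T n \<A> \<longleftrightarrow>
     (\<forall>(U, \<phi>) \<in> \<A>. chart T n U \<phi>) \<and>
     topspace T = (\<Union>(U, \<phi>) \<in> \<A>. U) \<and>
     (\<forall>(U, \<phi>) \<in> \<A>. \<forall>(V, \<psi>) \<in> \<A>.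
        smooth_map_on n n (\<phi> ` (U \<inter> V)) (\<lambda>x. \<psi> (inv_into U \<phi> x)))"

text \<open>The two halves of a point of \<open>\<real>\<^bsup>n+n\<^esup> = \<real>\<^bsup>n\<^esup> \<times> \<real>\<^bsup>n\<^esup>\<close>.\<close>

definition lower_half :: "nat \<Rightarrow> (nat \<Rightarrow> real) \<Rightarrow> nat \<Rightarrow> real" where
  "lower_half n z = (\<lambda>i. if i < n then z i else 0)"

definition upper_half :: "nat \<Rightarrow> (nat \<Rightarrow> real) \<Rightarrow> nat \<Rightarrow> real" where
  "upper_half n z = (\<lambda>i. if i < n then z (n + i) else 0)"

definition smooth_mult ::
    "('a, 'b) monoid_scheme \<Rightarrow> nat \<Rightarrow> ('a set \<times> ('a \<Rightarrow> nat \<Rightarrow> real)) set \<Rightarrow> bool" where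
  "smooth_mult G n \<A> \<longleftrightarrow>
     (\<forall>(U, \<phi>) \<in> \<A>. \<forall>(V, \<psi>) \<in> \<A>. \<forall>(W, \<theta>) \<in> \<A>.
        let m = (\<lambda>z. inv_into U \<phi> (lower_half n z) \<otimes>\<^bsub>G\<^esub> inv_into V \<psi> (upper_half n z)) in
        smooth_map_on (n + n) n
          {z \<in> topspace (Euclidean_space (n + n)).
             lower_half n z \<in> \<phi> ` U \<and> upper_half n z \<in> \<psi> ` V \<and> m z \<in> W}
          (\<lambda>z. \<theta> (m z)))"

definition smooth_inverse ::
    "('a, 'b) monoid_scheme \<Rightarrow> nat \<Rightarrow> ('a set \<times> ('a \<Rightarrow> nat \<Rightarrow> real)) set \<Rightarrow> bool" where
  "smooth_inverse G n \<A> \<longleftrightarrow>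
     (\<forall>(U, \<phi>) \<in> \<A>. \<forall>(W, \<theta>) \<in> \<A>.
        smooth_map_on n n (\<phi> ` {x \<in> U. inv\<^bsub>G\<^esub> x \<in> W})
          (\<lambda>x. \<theta> (inv\<^bsub>G\<^esub> (inv_into U \<phi> x))))"

text \<open>
  No countability of the topology is required, so every discrete group is a Lie group
  (with \<open>n = 0\<close>).
\<close>

definition Lie_group :: "('a, 'b) monoid_scheme \<Rightarrow> 'a topology \<Rightarrow> bool" where
  "Lie_group G T \<longleftrightarrow>
     topological_group G T \<and>
     (\<exists>n \<A>. smooth_atlas T n \<A> \<and> smooth_mult G n \<A> \<and> smooth_inverse G n \<A>)"

definition pro_Lie_group :: "('a, 'b) monoid_scheme \<Rightarrow> 'a topology \<Rightarrow> bool" where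
  "pro_Lie_group G T \<longleftrightarrow>
     topological_group G T \<and> complete_group G T \<and>
     (\<forall>U. openin T U \<and> \<one>\<^bsub>G\<^esub> \<in> U \<longrightarrow>
        (\<exists>N. N \<lhd> G \<and> closedin T N \<and> N \<subseteq> U \<and> Lie_group (G Mod N) (quotient_topology G T N)))"

end

theory Submission
  imports Defs
begin

text \<open>
  If some Lie quotient of \<open>G\<close> is infinite, it is \<open>\<sigma>\<close>-compact and locally Euclidean, hence second
  countable and regular, and Urysohn's metrization theorem applies. Otherwise all Lie quotients are
  finite. Then every ultrafilter on \<open>G\<close> contains a coset of each of the corresponding normal
  subgroups, so it is Cauchy and converges by completeness; thus \<open>G\<close> is compact and has arbitrarily
  small open normal subgroups of finite index. A strictly decreasing sequence of these has an
  intersection \<open>N\<close> of infinite index, and by compactness the images of their countably many cosets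
  form a base of \<open>G/N\<close>.
\<close>

section \<open>Urysohn's metrization theorem\<close>

text \<open>Urysohn functions attached to countably many pairs of basic open sets are the
  coordinates of an embedding into a countable product of real lines, which is metrizable.
  Normality, needed for these functions, comes from regularity and the Lindelof property.\<close>

theorem regular_second_countable_imp_metrizable_space:
  assumes reg: "regular_space X" and haus: "Hausdorff_space X" and sc: "second_countable X"
  shows "metrizable_space X"
proof -
  obtain \<B> where \<B>: "countable \<B>" "\<And>V. V \<in> \<B> \<Longrightarrow> openin X V"
    and "\<forall>U x. openin X U \<and> x \<in> U \<longrightarrow> (\<exists>V \<in> \<B>. x \<in> V \<and> V \<subseteq> U)"
    using sc by (auto simp: second_countable_def)
  then have base: "\<exists>V \<in> \<B>. x \<in> V \<and> V \<subseteq> U" if "openin X U" "x \<in> U" for U x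
    using that by blast
  have norm: "normal_space X"
    by (simp add: reg regular_Lindelof_imp_normal_space sc second_countable_imp_Lindelof_space)
  \<comment> \<open>Each pair leaves room for a Urysohn function that is 0 on the closure of
    \<open>U\<close> and 1 outside \<open>V\<close>. The index set is countable because
    \<open>\<B>\<close> is.\<close>
  define I where "I = {(U, V). U \<in> \<B> \<and> V \<in> \<B> \<and> X closure_of U \<subseteq> V}"
  have cI: "countable I"
    by (rule countable_subset[of _ "\<B> \<times> \<B>"]) (auto simp: I_def \<B>(1))
  have "\<forall>p\<in>I. \<exists>f. continuous_map X euclideanreal f \<and> f ` (X closure_of fst p) \<subseteq> {0}
      \<and> f ` (topspace X - snd p) \<subseteq> {1}"
  proof
    fix p assume "p \<in> I"
    have "closedin X (topspace X - snd p)"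
      using \<open>p \<in> I\<close> \<B>(2) by (auto simp: I_def)
    moreover have "disjnt (X closure_of fst p) (topspace X - snd p)"
      using \<open>p \<in> I\<close> by (auto simp: I_def disjnt_iff)
    ultimately show "\<exists>f. continuous_map X euclideanreal f \<and> f ` (X closure_of fst p) \<subseteq> {0}
      \<and> f ` (topspace X - snd p) \<subseteq> {1}"
      using norm[unfolded normal_space_iff_Urysohn_alt] by simp
  qed
  then have "\<exists>f. \<forall>p\<in>I. continuous_map X euclideanreal (f p) \<and> f p ` (X closure_of fst p) \<subseteq> {0}
      \<and> f p ` (topspace X - snd p) \<subseteq> {1}"
    by (rule bchoice)
  then obtain f where "\<forall>p\<in>I. continuous_map X euclideanreal (f p) \<and> f p ` (X closure_of fst p) \<subseteq> {0}
      \<and> f p ` (topspace X - snd p) \<subseteq> {1}"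
    by (elim exE)
  then have f: "\<And>p. p \<in> I \<Longrightarrow> continuous_map X euclideanreal (f p)"
    "\<And>p x. p \<in> I \<Longrightarrow> x \<in> X closure_of fst p \<Longrightarrow> f p x = 0"
    "\<And>p x. p \<in> I \<Longrightarrow> x \<in> topspace X - snd p \<Longrightarrow> f p x = 1"
    by (simp_all add: image_subset_iff)
  define Y where "Y = product_topology (\<lambda>_::'a set \<times> 'a set. euclideanreal) I"
  define F where "F = (\<lambda>x. \<lambda>p\<in>I. f p x)"
  \<comment> \<open>These functions separate points from closed sets: the complement of
    \<open>W\<close> is sent to 1 while \<open>x\<close> is sent to 0. The pair
    \<open>(B, V)\<close> comes from squeezing \<open>x \<in> B \<subseteq> U \<subseteq> C
    \<subseteq> V \<subseteq> W\<close> with \<open>C\<close> closed, so that the closure of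
    \<open>B\<close> stays inside \<open>C\<close> and hence inside \<open>V\<close>.\<close>
  have sep: "\<exists>p\<in>I. f p x = 0 \<and> (\<forall>y\<in>topspace X. f p y < 1 \<longrightarrow> y \<in> W)"
    if W: "openin X W" "x \<in> W" for W x
  proof -
    obtain V where V: "V \<in> \<B>" "x \<in> V" "V \<subseteq> W"
      using base W by blast
    obtain U C where UC: "openin X U" "closedin X C" "x \<in> U" "U \<subseteq> C" "C \<subseteq> V"
      using reg V \<B>(2) unfolding neighbourhood_base_of_closedin[symmetric] neighbourhood_base_of
      by metis
    obtain B where B: "B \<in> \<B>" "x \<in> B" "B \<subseteq> U"
      using base UC by blast
    have "X closure_of B \<subseteq> V"
      using B UC closure_of_minimal[of B C X] by blast
    then have p: "(B, V) \<in> I"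
      using B V by (auto simp: I_def)
    have "x \<in> X closure_of B"
      using B \<B>(2) by (meson closure_of_subset openin_subset subsetD)
    then show ?thesis
      using f(2,3)[OF p] V p by (intro bexI[of _ "(B, V)"]) force+
  qed
  have "continuous_map X Y F"
    unfolding Y_def F_def continuous_map_componentwise using f(1) by auto
  have inj: "inj_on F (topspace X)"
  proof (rule inj_onI, rule ccontr)
    fix x y assume xy: "x \<in> topspace X" "y \<in> topspace X" "F x = F y" "x \<noteq> y"
    then obtain W where W: "openin X W" "x \<in> W" "y \<notin> W"
      using haus unfolding Hausdorff_space_def disjnt_iff by metis
    then obtain p where p: "p \<in> I" "f p x = 0" "f p y < 1 \<longrightarrow> y \<in> W"
      using sep xy by blast
    then have "F x p = F y p" using xy by simp
    then show False using p W by (simp add: F_def)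
  qed
  have "open_map X (subtopology Y (F ` topspace X)) F"
    unfolding open_map_def
  proof (intro strip)
    fix W assume W: "openin X W"
    show "openin (subtopology Y (F ` topspace X)) (F ` W)"
    proof (subst openin_subopen, intro strip)
      fix z assume "z \<in> F ` W"
      then obtain x where x: "x \<in> W" "z = F x" by blast
      obtain p where p: "p \<in> I" "f p x = 0" "\<forall>y\<in>topspace X. f p y < 1 \<longrightarrow> y \<in> W"
        using sep W x by blast
      have "openin Y {g \<in> topspace Y. g p \<in> {..<1}}"
        unfolding Y_def
        by (rule openin_continuous_map_preimage[OF continuous_map_product_projection[OF p(1)]]) simp
      then have o: "openin (subtopology Y (F ` topspace X)) ({g \<in> topspace Y. g p \<in> {..<1}} \<inter> F ` topspace X)"
        by (auto simp: openin_subtopology)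
      have "x \<in> topspace X" using W x openin_subset by blast
      moreover have "F x \<in> topspace Y" by (auto simp: Y_def F_def)
      ultimately have "z \<in> {g \<in> topspace Y. g p \<in> {..<1}} \<inter> F ` topspace X"
        using x p by (auto simp: F_def)
      moreover have "{g \<in> topspace Y. g p \<in> {..<1}} \<inter> F ` topspace X \<subseteq> F ` W"
        using p by (auto simp: F_def)
      ultimately show "\<exists>T. openin (subtopology Y (F ` topspace X)) T \<and> z \<in> T \<and> T \<subseteq> F ` W"
        using o by blast
    qed
  qed
  moreover have "continuous_map X (subtopology Y (F ` topspace X)) F"
    using \<open>continuous_map X Y F\<close> by (simp add: continuous_map_in_subtopology)
  ultimately have "embedding_map X (subtopology Y (F ` topspace X)) F"
    using inj injective_open_imp_embedding_map by blast
  then have "embedding_map X Y F"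
    by (simp add: embedding_map_in_subtopology)
  moreover have "metrizable_space Y"
    unfolding Y_def metrizable_space_product_topology
    by (auto simp: metrizable_space_euclidean intro: countable_subset[OF _ cI])
  ultimately show ?thesis
    using embedding_map_imp_homeomorphic_space homeomorphic_metrizable_space
      metrizable_space_subtopology by blast
qed


section \<open>\<open>\<sigma>\<close>-compact Lie groups\<close>

lemma sigma_compact_imp_Lindelof_space:
  assumes "sigma_compact_space X"
  shows "Lindelof_space X"
proof -
  obtain K :: "nat \<Rightarrow> 'a set" where K: "\<And>i. compactin X (K i)" "topspace X = (\<Union>i. K i)"
    using assms unfolding sigma_compact_space_def by blast
  have "Lindelof_space (subtopology X (\<Union>(range K)))"
    by (rule Lindelof_space_Union)
      (auto intro!: compact_imp_Lindelof_space compact_space_subtopology K(1))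
  then show ?thesis
    by (simp add: K(2)[symmetric])
qed

lemma sigma_compact_space_continuous_map_image:
  assumes "sigma_compact_space X" "continuous_map X Y f" "f ` topspace X = topspace Y"
  shows "sigma_compact_space Y"
proof -
  obtain K :: "nat \<Rightarrow> 'a set" where K: "\<And>i. compactin X (K i)" "topspace X = (\<Union>i. K i)"
    using assms unfolding sigma_compact_space_def by blast
  have "topspace Y = (\<Union>i. f ` K i)"
    using assms(3) K(2) by blast
  then show ?thesis
    unfolding sigma_compact_space_def
    using image_compactin[OF K(1) assms(2)] by (intro exI[of _ "\<lambda>i. f ` K i"]) auto
qed

text \<open>Countably many of the given open pieces cover the space. Sets open in an open piece are
  open in \<open>X\<close>, so the union of the countable bases of these pieces is a countable base
  of \<open>X\<close>.\<close>

lemma locally_second_countable_Lindelof_imp_second_countable: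
  assumes lin: "Lindelof_space X"
    and loc: "\<And>x. x \<in> topspace X \<Longrightarrow>
      \<exists>U. openin X U \<and> x \<in> U \<and> second_countable (subtopology X U)"
  shows "second_countable X"
proof -
  define \<U> where "\<U> = {U. openin X U \<and> second_countable (subtopology X U)}"
  have "\<Union>\<U> = topspace X"
    using loc openin_subset unfolding \<U>_def by blast
  then obtain \<V> where \<V>: "countable \<V>" "\<V> \<subseteq> \<U>" "\<Union>\<V> = topspace X"
    using lin unfolding Lindelof_space_def \<U>_def by (metis (no_types, lifting) mem_Collect_eq)
  have "\<exists>\<B>. countable \<B> \<and> (\<forall>B\<in>\<B>. openin X B) \<and>
      (\<forall>W x. openin X W \<and> x \<in> W \<and> W \<subseteq> U \<longrightarrow> (\<exists>B\<in>\<B>. x \<in> B \<and> B \<subseteq> W))" if "U \<in> \<V>" for U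
  proof -
    have U: "openin X U" "second_countable (subtopology X U)"
      using that \<V>(2) by (auto simp: \<U>_def)
    then obtain \<B> where "countable \<B>" "\<forall>V \<in> \<B>. openin (subtopology X U) V"
      "\<forall>W x. openin (subtopology X U) W \<and> x \<in> W \<longrightarrow> (\<exists>V \<in> \<B>. x \<in> V \<and> V \<subseteq> W)"
      unfolding second_countable_def by blast
    then show ?thesis
      using openin_open_subtopology[OF U(1)] by (intro exI[of _ \<B>]) auto
  qed
  then obtain B where B: "\<And>U. U \<in> \<V> \<Longrightarrow> countable (B U)"
    "\<And>U W. U \<in> \<V> \<Longrightarrow> W \<in> B U \<Longrightarrow> openin X W"
    "\<And>U W x. U \<in> \<V> \<Longrightarrow> openin X W \<Longrightarrow> x \<in> W \<Longrightarrow> W \<subseteq> U \<Longrightarrow> \<exists>V\<in>B U. x \<in> V \<and> V \<subseteq> W"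
    by metis
  show ?thesis
    unfolding second_countable_def
  proof (intro exI[of _ "\<Union>U\<in>\<V>. B U"] conjI strip)
    show "countable (\<Union>U\<in>\<V>. B U)" using \<V>(1) B(1) by blast
    show "openin X V" if "V \<in> (\<Union>U\<in>\<V>. B U)" for V using that B(2) by blast
    fix W x assume W: "openin X W \<and> x \<in> W"
    then obtain U where U: "U \<in> \<V>" "x \<in> U" using \<V>(3) openin_subset by blast
    then have "openin X (W \<inter> U)" using W \<V>(2) by (auto simp: \<U>_def)
    then obtain V where "V \<in> B U" "x \<in> V" "V \<subseteq> W \<inter> U"
      using B(3)[OF U(1), of "W \<inter> U" x] W U by blast
    then show "\<exists>V\<in>\<Union>U\<in>\<V>. B U. x \<in> V \<and> V \<subseteq> W" using U by blast
  qed
qed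

text \<open>A compact neighbourhood inside an open piece is still a compact neighbourhood in the
  whole space.\<close>

lemma locally_compact_space_open_cover:
  assumes "\<And>x. x \<in> topspace X \<Longrightarrow>
      \<exists>U. openin X U \<and> x \<in> U \<and> locally_compact_space (subtopology X U)"
  shows "locally_compact_space X"
  unfolding locally_compact_space_def
proof (intro strip)
  fix x assume x: "x \<in> topspace X"
  then obtain U where U: "openin X U" "x \<in> U" "locally_compact_space (subtopology X U)"
    using assms by blast
  then obtain V K where VK: "openin (subtopology X U) V" "compactin (subtopology X U) K" "x \<in> V" "V \<subseteq> K"
    using x unfolding locally_compact_space_def topspace_subtopology by blast
  then have "openin X V" "compactin X K"
    using U(1) by (simp_all add: openin_open_subtopology compactin_subtopology)
  with VK show "\<exists>U K. openin X U \<and> compactin X K \<and> x \<in> U \<and> U \<subseteq> K"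
    by blast
qed

section \<open>Topological consequences of charts\<close>

lemma second_countable_Euclidean_space: "second_countable (Euclidean_space n)"
proof -
  obtain \<B> :: "(nat \<Rightarrow> real) set set" where \<B>: "countable \<B>" "\<And>C. C \<in> \<B> \<Longrightarrow> open C"
       "\<And>S. open S \<Longrightarrow> \<exists>U. U \<subseteq> \<B> \<and> S = \<Union>U"
    using univ_second_countable by blast
  have "second_countable (euclidean :: (nat \<Rightarrow> real) topology)"
    unfolding second_countable_def
  proof (intro exI[of _ \<B>] conjI strip)
    fix U :: "(nat \<Rightarrow> real) set" and x assume "openin euclidean U \<and> x \<in> U"
    then show "\<exists>V\<in>\<B>. x \<in> V \<and> V \<subseteq> U"
      using \<B>(3)[of U] by auto
  qed (use \<B> in auto)
  \<comment> \<open>\<open>Euclidean_space n\<close> is a subspace of the countable power of the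
    real line, whose product topology is the standard topology on
    \<open>nat \<Rightarrow> real\<close>.\<close>
  then show ?thesis
    unfolding Euclidean_space_def euclidean_product_topology
    by (rule second_countable_subtopology)
qed

lemma chart_imp_second_countable:
  assumes "chart T n U \<phi>"
  shows "second_countable (subtopology T U)"
  using assms homeomorphic_map_imp_homeomorphic_space homeomorphic_space_second_countability
    second_countable_subtopology[OF second_countable_Euclidean_space]
  unfolding chart_def by blast

text \<open>Local compactness passes to open subsets of the locally compact Hausdorff
  \<open>Euclidean_space n\<close> and back along the chart.\<close>

lemma chart_imp_locally_compact_space:
  assumes "chart T n U \<phi>"
  shows "locally_compact_space (subtopology T U)"
proof -
  have "locally_compact_space (subtopology (Euclidean_space n) (\<phi> ` U))"
    using assms locally_compact_space_open_subset Hausdorff_Euclidean_space locally_compact_Euclidean_space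
    unfolding chart_def by blast
  then show ?thesis
    using assms homeomorphic_map_imp_homeomorphic_space homeomorphic_locally_compact_space
    unfolding chart_def by blast
qed

text \<open>Charts make the space locally compact, hence regular since it is Hausdorff. They also
  make it locally second countable, and \<sigma>-compactness turns this into a global countable base
  through the Lindelof property.\<close>

lemma sigma_compact_Lie_group_separable_metrizable:
  assumes lie: "Lie_group G T" and sc: "sigma_compact_space T"
  shows "separable_space T" "metrizable_space T"
proof -
  obtain n \<A> where \<A>: "smooth_atlas T n \<A>"
    using lie unfolding Lie_group_def by blast
  have cov: "\<exists>U \<phi>. x \<in> U \<and> chart T n U \<phi>" if "x \<in> topspace T" for x
  proof -
    have "x \<in> (\<Union>(U, \<phi>) \<in> \<A>. U)"
      using \<A> that by (simp add: smooth_atlas_def)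
    then obtain U \<phi> where "(U, \<phi>) \<in> \<A>" "x \<in> U" by auto
    moreover have "\<forall>(U, \<phi>) \<in> \<A>. chart T n U \<phi>"
      using \<A> by (simp add: smooth_atlas_def)
    ultimately show ?thesis by blast
  qed
  have haus: "Hausdorff_space T"
    using lie unfolding Lie_group_def topological_group_def by blast
  have "locally_compact_space T"
    by (rule locally_compact_space_open_cover) (meson cov chart_def chart_imp_locally_compact_space)
  then have "regular_space T"
    using haus locally_compact_Hausdorff_imp_regular_space by blast
  moreover have c2: "second_countable T"
    by (rule locally_second_countable_Lindelof_imp_second_countable)
      (meson sc sigma_compact_imp_Lindelof_space, meson cov chart_def chart_imp_second_countable)
  ultimately show "separable_space T" "metrizable_space T"
    using haus second_countable_imp_separable_space regular_second_countable_imp_metrizable_space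
    by blast+
qed


section \<open>Compactness of complete groups with finite quotients\<close>

lemma exists_ultrafilter_le:
  fixes F :: "'a filter"
  assumes "F \<noteq> bot"
  obtains U where "U \<le> F" "U \<noteq> bot" "\<And>P. eventually P U \<or> eventually (\<lambda>x. \<not> P x) U"
proof -
  define A where "A = {G. G \<noteq> bot \<and> G \<le> F}"
  \<comment> \<open>Zorn's lemma is applied to the reversed order, so it yields a minimal proper
    filter below \<open>F\<close>.\<close>
  have "\<exists>m\<in>A. \<forall>a\<in>A. m \<ge> a \<longrightarrow> a = m"
  proof (rule predicate_Zorn)
    show "partial_order_on A (relation_of (\<ge>) A)"
      by (rule partial_order_on_relation_ofI) auto
    fix C assume C: "C \<in> Chains (relation_of (\<ge>) A)"
    then have sub: "C \<subseteq> A" and tot: "\<And>a b. a \<in> C \<Longrightarrow> b \<in> C \<Longrightarrow> a \<le> b \<or> b \<le> a"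
      by (auto simp: Chains_def relation_of_def)
    show "\<exists>u\<in>A. \<forall>a\<in>C. u \<le> a"
    proof (cases "C = {}")
      case True
      then show ?thesis using assms by (auto simp: A_def)
    next
      case False
      \<comment> \<open>Since a chain is directed, its infimum could be improper only if some member
        were.\<close>
      have "eventually (\<lambda>_. False) (Inf C) \<longleftrightarrow> (\<exists>b\<in>C. eventually (\<lambda>_. False) b)"
        by (rule eventually_Inf_base[OF False]) (use tot in fastforce)
      then have "Inf C \<noteq> bot"
        using sub by (auto simp: A_def trivial_limit_def)
      moreover have "Inf C \<le> F"
        using False sub by (auto simp: A_def intro: Inf_lower2)
      ultimately have "Inf C \<in> A" by (simp add: A_def)
      then show ?thesis by (blast intro: Inf_lower)
    qed
  qed
  then obtain U where "U \<in> A" and maxA: "\<And>G. G \<in> A \<Longrightarrow> G \<le> U \<Longrightarrow> G = U"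
    by blast
  then have U: "U \<noteq> bot" "U \<le> F" by (auto simp: A_def)
  have max: "G = U" if "G \<noteq> bot" "G \<le> U" for G
    using maxA that order_trans[OF that(2) U(2)] by (simp add: A_def)
  have "eventually P U" if "\<not> eventually (\<lambda>x. \<not> P x) U" for P
  proof -
    \<comment> \<open>Restricting \<open>U\<close> to the points satisfying \<open>P\<close> keeps
      it proper, so minimality forces the restriction to be \<open>U\<close> itself.\<close>
    have "inf U (principal {x. P x}) \<noteq> bot"
      using that by (simp add: trivial_limit_def eventually_inf_principal)
    then have "inf U (principal {x. P x}) = U"
      by (rule max) simp
    moreover have "eventually P (inf U (principal {x. P x}))"
      by (simp add: eventually_inf_principal)
    ultimately show ?thesis by simp
  qed
  then show thesis
    using U that by blast
qed

text \<open>A family of closed sets with the finite intersection property generates a proper filter.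
  A limit of any finer ultrafilter lies in every member of the family.\<close>

lemma compact_space_if_ultrafilters_converge:
  assumes conv: "\<And>F. F \<noteq> bot \<Longrightarrow> eventually (\<lambda>x. x \<in> topspace X) F \<Longrightarrow>
      (\<And>P. eventually P F \<or> eventually (\<lambda>x. \<not> P x) F) \<Longrightarrow> \<exists>l. limitin X (\<lambda>x. x) l F"
  shows "compact_space X"
  unfolding compact_space_fip
proof (intro strip)
  fix \<U> assume \<U>: "(\<forall>C\<in>\<U>. closedin X C) \<and> (\<forall>\<F>. finite \<F> \<and> \<F> \<subseteq> \<U> \<longrightarrow> \<Inter>\<F> \<noteq> {})"
  show "\<Inter>\<U> \<noteq> {}"
  proof (cases "\<U> = {}")
    case False
    have "(INF C\<in>\<U>. principal C) \<noteq> bot"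
    proof (rule INF_filter_not_bot)
      fix \<F> assume "\<F> \<subseteq> \<U>" "finite \<F>"
      then show "(INF C\<in>\<F>. principal C) \<noteq> bot"
        using \<U> by (simp add: INF_principal_finite principal_eq_bot_iff)
    qed
    then obtain F where F: "F \<le> (INF C\<in>\<U>. principal C)" "F \<noteq> bot"
      "\<And>P. eventually P F \<or> eventually (\<lambda>x. \<not> P x) F"
      using exists_ultrafilter_le by blast
    have ev: "eventually (\<lambda>x. x \<in> C) F" if "C \<in> \<U>" for C
      using F(1) that by (simp add: le_INF_iff le_principal)
    \<comment> \<open>Any one member places the ultrafilter inside \<open>topspace X\<close>. This
      is why the empty family, with intersection \<open>UNIV\<close>, is treated separately.\<close>
    obtain C where C: "C \<in> \<U>" using False by blast
    then have "eventually (\<lambda>x. x \<in> topspace X) F"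
      using ev[OF C] \<U> closedin_subset by (metis (mono_tags, lifting) eventually_mono subsetD)
    then obtain l where "limitin X (\<lambda>x. x) l F"
      using conv F by blast
    then have "l \<in> C" if "C \<in> \<U>" for C
      by (rule limitin_closedin) (use \<U> ev F(2) that in auto)
    then show ?thesis by blast
  qed auto
qed

text \<open>If no piece belonged to the ultrafilter, all the complements would, and so would their
  finite intersection, contradicting the cover.\<close>

lemma ultrafilter_finite_cover:
  assumes ultra: "\<And>P. eventually P F \<or> eventually (\<lambda>x. \<not> P x) F"
    and "F \<noteq> bot" "finite I" "eventually (\<lambda>x. \<exists>i\<in>I. x \<in> S i) F"
  obtains i where "i \<in> I" "eventually (\<lambda>x. x \<in> S i) F"
proof -
  have "\<exists>i\<in>I. eventually (\<lambda>x. x \<in> S i) F"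
  proof (rule ccontr)
    assume "\<not> ?thesis"
    then have "eventually (\<lambda>x. \<forall>i\<in>I. x \<notin> S i) F"
      using ultra \<open>finite I\<close> by (intro eventually_ball_finite) auto
    with assms(4) have "eventually (\<lambda>x. False) F"
      by eventually_elim blast
    then show False using \<open>F \<noteq> bot\<close> by (simp add: trivial_limit_def)
  qed
  then show thesis using that by blast
qed

section \<open>Cosets and Cauchy ultrafilters\<close>

lemma (in normal) rcos_eq_iff:
  assumes "x \<in> carrier G" "y \<in> carrier G"
  shows "H #> x = H #> y \<longleftrightarrow> x \<otimes> inv y \<in> H"
  using assms by (metis is_group is_subgroup group.repr_independence rcos_module group.rcos_self)

text \<open>An ultrafilter must contain one of the finitely many cosets of \<open>N\<close>. Two
  elements of one coset differ, on either side, by an element of \<open>N \<subseteq> U\<close>, so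
  the ultrafilter is Cauchy and completeness gives a limit.\<close>

lemma finite_quotients_complete_imp_compact_space:
  assumes comp: "complete_group G T" and G: "group G" and top: "topspace T = carrier G"
    and fin: "\<And>U. openin T U \<Longrightarrow> \<one>\<^bsub>G\<^esub> \<in> U \<Longrightarrow>
        \<exists>N. N \<lhd> G \<and> N \<subseteq> U \<and> finite (carrier (G Mod N))"
  shows "compact_space T"
proof (rule compact_space_if_ultrafilters_converge)
  interpret group G by (rule G)
  fix F :: "'a filter"
  assume F: "F \<noteq> bot" "eventually (\<lambda>x. x \<in> topspace T) F"
    "\<And>P. eventually P F \<or> eventually (\<lambda>x. \<not> P x) F"
  have "\<exists>A\<subseteq>carrier G. eventually (\<lambda>x. x \<in> A) F \<and>
      (\<forall>x\<in>A. \<forall>y\<in>A. inv\<^bsub>G\<^esub> x \<otimes>\<^bsub>G\<^esub> y \<in> U \<and> x \<otimes>\<^bsub>G\<^esub> inv\<^bsub>G\<^esub> y \<in> U)"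
    if U: "openin T U" "\<one>\<^bsub>G\<^esub> \<in> U" for U
  proof -
    obtain N where N: "N \<lhd> G" "N \<subseteq> U" "finite (carrier (G Mod N))"
      using fin U by blast
    interpret normal N G by (rule N(1))
    have "eventually (\<lambda>x. \<exists>A\<in>carrier (G Mod N). x \<in> A) F"
      using F(2) by (rule eventually_mono) (auto simp: carrier_FactGroup top intro: rcos_self is_subgroup)
    then obtain A where A: "A \<in> carrier (G Mod N)" "eventually (\<lambda>x. x \<in> A) F"
      using ultrafilter_finite_cover[of F "carrier (G Mod N)" "\<lambda>A. A"] F N(3) by blast
    then obtain a where a: "a \<in> carrier G" "A = N #>\<^bsub>G\<^esub> a"
      by (auto simp: carrier_FactGroup)
    then have sub: "A \<subseteq> carrier G" using r_coset_subset_G subset by blast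
    have right: "x \<otimes>\<^bsub>G\<^esub> inv\<^bsub>G\<^esub> y \<in> N" if "x \<in> A" "y \<in> A" for x y
      using that a sub repr_independence[OF _ _ is_subgroup] rcos_eq_iff by (metis subsetD)
    have "inv\<^bsub>G\<^esub> x \<otimes>\<^bsub>G\<^esub> y \<in> N" if xy: "x \<in> A" "y \<in> A" for x y
    proof -
      have c: "x \<in> carrier G" "y \<in> carrier G" using xy sub by auto
      \<comment> \<open>Normality passes from right to left differences: conjugating
        \<open>y\<close> times the inverse of \<open>x\<close> by \<open>x\<close> gives the inverse
        of \<open>x\<close> times \<open>y\<close>.\<close>
      have "inv\<^bsub>G\<^esub> x \<otimes>\<^bsub>G\<^esub> (y \<otimes>\<^bsub>G\<^esub> inv\<^bsub>G\<^esub> x) \<otimes>\<^bsub>G\<^esub> x \<in> N"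
        using right xy c inv_op_closed1 by simp
      then show ?thesis using c by (simp add: m_assoc)
    qed
    with right show ?thesis using A(2) sub N(2) by blast
  qed
  then have "group_Cauchy_filter G T F"
    using F by (simp add: group_Cauchy_filter_def top)
  then show "\<exists>l. limitin T (\<lambda>x. x) l F"
    using comp unfolding complete_group_def by blast
qed


section \<open>Infinite metrizable quotients of profinite groups\<close>

text \<open>The coset is the preimage of \<open>N\<close> under right translation by the inverse of
  \<open>x\<close>, which is continuous.\<close>

lemma topological_group_coset:
  assumes tg: "topological_group G T" and N: "N \<lhd> G" and x: "x \<in> carrier G"
  shows "openin T N \<Longrightarrow> openin T (N #>\<^bsub>G\<^esub> x)" "closedin T N \<Longrightarrow> closedin T (N #>\<^bsub>G\<^esub> x)"
proof -
  interpret normal N G by (rule N)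
  have top: "topspace T = carrier G" using tg by (simp add: topological_group_def)
  have "continuous_map T (prod_topology T T) (\<lambda>y. (y, inv\<^bsub>G\<^esub> x))"
    using x top by (simp add: continuous_map_pairwise o_def)
  moreover have "continuous_map (prod_topology T T) T (\<lambda>(x, y). x \<otimes>\<^bsub>G\<^esub> y)"
    using tg by (simp add: topological_group_def)
  ultimately have "continuous_map T T ((\<lambda>(x, y). x \<otimes>\<^bsub>G\<^esub> y) \<circ> (\<lambda>y. (y, inv\<^bsub>G\<^esub> x)))"
    by (rule continuous_map_compose)
  then have cont: "continuous_map T T (\<lambda>y. y \<otimes>\<^bsub>G\<^esub> inv\<^bsub>G\<^esub> x)"
    by (simp add: o_def)
  have eq: "N #>\<^bsub>G\<^esub> x = {y \<in> topspace T. y \<otimes>\<^bsub>G\<^esub> inv\<^bsub>G\<^esub> x \<in> N}"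
    using rcos_module[OF is_group x] r_coset_subset_G[OF subset x] unfolding top by blast
  show "openin T N \<Longrightarrow> openin T (N #>\<^bsub>G\<^esub> x)"
    unfolding eq by (rule openin_continuous_map_preimage[OF cont])
  show "closedin T N \<Longrightarrow> closedin T (N #>\<^bsub>G\<^esub> x)"
    unfolding eq by (rule closedin_continuous_map_preimage[OF cont])
qed

text \<open>A finite Hausdorff space is discrete, and \<open>N\<close> is the preimage of the
  identity point of the quotient.\<close>

lemma openin_if_finite_Hausdorff_quotient:
  assumes top: "topspace T = carrier G" and N: "N \<lhd> G"
    and fin: "finite (carrier (G Mod N))" and haus: "Hausdorff_space (quotient_topology G T N)"
  shows "openin T N"
proof -
  interpret normal N G by (rule N)
  have q: "topspace (quotient_topology G T N) = carrier (G Mod N)"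
    using quotient_imp_surjective_map[OF quotient_map_quotient_topology[OF top, of N]] top
    by (simp add: carrier_FactGroup)
  have "quotient_topology G T N = discrete_topology (carrier (G Mod N))"
    using finite_topspace_imp_discrete_topology[OF q fin haus] .
  moreover have N1: "N = N #>\<^bsub>G\<^esub> \<one>\<^bsub>G\<^esub>" using subset by simp
  then have "N \<in> carrier (G Mod N)" by (auto simp: carrier_FactGroup)
  ultimately have "openin (quotient_topology G T N) {N}" by simp
  then have "openin T {x \<in> carrier G. N #>\<^bsub>G\<^esub> x = N}"
    by (simp add: openin_quotient_topology)
  moreover have "{x \<in> carrier G. N #>\<^bsub>G\<^esub> x = N} = N"
    using rcos_eq_iff[of _ "\<one>\<^bsub>G\<^esub>"] N1 subset by auto
  ultimately show ?thesis by simp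
qed

section \<open>Quotients by the intersection of a decreasing sequence\<close>

lemma (in group) normal_Inter_seq:
  fixes M :: "nat \<Rightarrow> 'a set"
  assumes "\<And>i. M i \<lhd> G"
  shows "(\<Inter>i. M i) \<lhd> G"
  unfolding normal_inv_iff
proof (intro conjI ballI)
  have "subgroup (\<Inter>(range M)) G"
    using assms by (intro subgroups_Inter) (auto simp: normal_imp_subgroup)
  then show "subgroup (\<Inter>i. M i) G" by simp
  fix x h assume "x \<in> carrier G" "h \<in> (\<Inter>i. M i)"
  then show "x \<otimes> h \<otimes> inv x \<in> (\<Inter>i. M i)"
    using assms by (auto simp: normal_inv_iff)
qed

text \<open>Elements \<open>x i\<close> of \<open>M i\<close> outside \<open>M (Suc i)\<close>
  represent pairwise distinct cosets. For \<open>i < j\<close> the element \<open>x j\<close> lies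
  in \<open>M (Suc i)\<close>, so equal cosets would force \<open>x i\<close> into
  \<open>M (Suc i)\<close> as well.\<close>

lemma infinite_quotient_by_decreasing_Inter:
  fixes M :: "nat \<Rightarrow> 'a set"
  assumes N: "(\<Inter>i. M i) \<lhd> G" and M: "\<And>i. M i \<lhd> G" and dec: "\<And>i. M (Suc i) \<subset> M i"
  shows "infinite (carrier (G Mod (\<Inter>i. M i)))"
proof
  define N where "N = (\<Inter>i. M i)"
  interpret normal N G unfolding N_def by (rule N)
  assume "finite (carrier (G Mod (\<Inter>i. M i)))"
  moreover have "\<exists>x. x \<in> M i \<and> x \<notin> M (Suc i)" for i
    using dec[of i] by blast
  then obtain x where x: "\<And>i. x i \<in> M i" "\<And>i. x i \<notin> M (Suc i)"
    by metis
  have xc: "x i \<in> carrier G" for i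
    using x(1) M normal_imp_subgroup subgroup.mem_carrier by metis
  have anti: "i \<le> j \<Longrightarrow> M j \<subseteq> M i" for i j
    by (rule lift_Suc_antimono_le[of M]) (use dec in auto)
  have "N #>\<^bsub>G\<^esub> x i \<noteq> N #>\<^bsub>G\<^esub> x j" if "i < j" for i j
  proof
    assume "N #>\<^bsub>G\<^esub> x i = N #>\<^bsub>G\<^esub> x j"
    then have "x i \<otimes>\<^bsub>G\<^esub> inv\<^bsub>G\<^esub> x j \<in> M (Suc i)"
      using rcos_eq_iff xc by (auto simp: N_def)
    moreover have "x j \<in> M (Suc i)"
      using x(1) anti[of "Suc i" j] that by auto
    ultimately have "x i \<otimes>\<^bsub>G\<^esub> inv\<^bsub>G\<^esub> x j \<otimes>\<^bsub>G\<^esub> x j \<in> M (Suc i)"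
      using M normal_imp_subgroup subgroup.m_closed by metis
    then show False
      using x(2) xc by (simp add: m_assoc)
  qed
  then have "inj (\<lambda>i. N #>\<^bsub>G\<^esub> x i)"
    by (intro linorder_injI) auto
  moreover have "range (\<lambda>i. N #>\<^bsub>G\<^esub> x i) \<subseteq> carrier (G Mod N)"
    using xc by (auto simp: carrier_FactGroup)
  ultimately show False
    using finite_subset finite_imageD infinite_UNIV_nat unfolding N_def by metis
qed

text \<open>The images of the cosets of all the \<open>M i\<close> form a countable base of the
  quotient. Being also compact Hausdorff, the quotient is regular, and Urysohn's theorem
  applies.\<close>

lemma compact_quotient_by_decreasing_Inter_separable_metrizable:
  fixes M :: "nat \<Rightarrow> 'a set"
  assumes tg: "topological_group G T" and comp: "compact_space T"
    and N: "(\<Inter>i. M i) \<lhd> G" and M: "\<And>i. M i \<lhd> G" and opn: "\<And>i. openin T (M i)"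
    and cl: "\<And>i. closedin T (M i)"
    and fin: "\<And>i. finite (carrier (G Mod M i))" and dec: "\<And>i. M (Suc i) \<subseteq> M i"
  shows "separable_space (quotient_topology G T (\<Inter>i. M i))"
    and "metrizable_space (quotient_topology G T (\<Inter>i. M i))"
proof -
  define N where "N = (\<Inter>i. M i)"
  interpret normal N G unfolding N_def by (rule N)
  have top: "topspace T = carrier G" using tg by (simp add: topological_group_def)
  define Q where "Q = quotient_topology G T N"
  define \<pi> where "\<pi> = (\<lambda>x. N #>\<^bsub>G\<^esub> x)"
  have qm: "quotient_map T Q \<pi>"
    unfolding Q_def \<pi>_def by (rule quotient_map_quotient_topology[OF top])
  have opQ: "openin Q W \<longleftrightarrow> W \<subseteq> \<pi> ` carrier G \<and> openin T {x \<in> carrier G. \<pi> x \<in> W}" for W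
    unfolding Q_def \<pi>_def openin_quotient_topology carrier_FactGroup by simp
  have topQ: "topspace Q = \<pi> ` carrier G"
    using quotient_imp_surjective_map[OF qm] top by simp
  have coset_iff: "y \<in> M i #>\<^bsub>G\<^esub> x \<longleftrightarrow> y \<otimes>\<^bsub>G\<^esub> inv\<^bsub>G\<^esub> x \<in> M i"
    if "x \<in> carrier G" "y \<in> carrier G" for i x y
    using subgroup.rcos_module[OF normal_imp_subgroup[OF M] is_group that] .
  have coset_eq: "M i #>\<^bsub>G\<^esub> x = M i #>\<^bsub>G\<^esub> y \<longleftrightarrow> x \<otimes>\<^bsub>G\<^esub> inv\<^bsub>G\<^esub> y \<in> M i"
    if "x \<in> carrier G" "y \<in> carrier G" for i x y
    using normal.rcos_eq_iff[OF M that] .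
  have coset_sub: "M i #>\<^bsub>G\<^esub> x \<subseteq> carrier G" if "x \<in> carrier G" for i x
    using r_coset_subset_G subgroup.subset[OF normal_imp_subgroup[OF M]] that by blast
  \<comment> \<open>Because \<open>N \<subseteq> M i\<close>, every coset of \<open>M i\<close> is a
    union of fibres of \<open>\<pi>\<close>. Its image is therefore open, and disjoint cosets have
    disjoint images.\<close>
  have \<pi>_coset: "\<pi> y \<in> \<pi> ` (M i #>\<^bsub>G\<^esub> x) \<longleftrightarrow> y \<in> M i #>\<^bsub>G\<^esub> x"
    if xy: "x \<in> carrier G" "y \<in> carrier G" for i x y
  proof
    assume "\<pi> y \<in> \<pi> ` (M i #>\<^bsub>G\<^esub> x)"
    then obtain z where z: "z \<in> M i #>\<^bsub>G\<^esub> x" "\<pi> y = \<pi> z" by blast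
    then have zc: "z \<in> carrier G" using coset_sub xy by blast
    have "y \<otimes>\<^bsub>G\<^esub> inv\<^bsub>G\<^esub> z \<in> M i"
      using z(2) rcos_eq_iff xy zc by (auto simp: N_def \<pi>_def)
    then have "M i #>\<^bsub>G\<^esub> y = M i #>\<^bsub>G\<^esub> x"
      using coset_eq coset_iff z(1) zc xy by metis
    then show "y \<in> M i #>\<^bsub>G\<^esub> x"
      using coset_eq coset_iff xy by blast
  qed blast
  have opB: "openin Q (\<pi> ` (M i #>\<^bsub>G\<^esub> x))" if x: "x \<in> carrier G" for i x
  proof -
    have "{y \<in> carrier G. \<pi> y \<in> \<pi> ` (M i #>\<^bsub>G\<^esub> x)} = M i #>\<^bsub>G\<^esub> x"
      using \<pi>_coset[OF x] coset_sub[OF x] by blast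
    then show ?thesis
      using topological_group_coset(1)[OF tg M x opn] coset_sub[OF x] by (simp add: opQ image_mono)
  qed
  have haus: "Hausdorff_space Q"
    unfolding Hausdorff_space_def
  proof (intro strip)
    fix p q assume pq: "p \<in> topspace Q \<and> q \<in> topspace Q \<and> p \<noteq> q"
    then obtain x y where xy: "x \<in> carrier G" "p = \<pi> x" "y \<in> carrier G" "q = \<pi> y"
      by (auto simp: topQ)
    then have "x \<otimes>\<^bsub>G\<^esub> inv\<^bsub>G\<^esub> y \<notin> N" using pq rcos_eq_iff by (auto simp: \<pi>_def)
    \<comment> \<open>An element outside \<open>N\<close> is already missed by some
      \<open>M i\<close>, and the cosets of this \<open>M i\<close> through \<open>x\<close> and
      \<open>y\<close> separate the two points.\<close>
    then obtain i where i: "x \<otimes>\<^bsub>G\<^esub> inv\<^bsub>G\<^esub> y \<notin> M i" by (auto simp: N_def)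
    have "disjnt (\<pi> ` (M i #>\<^bsub>G\<^esub> x)) (\<pi> ` (M i #>\<^bsub>G\<^esub> y))"
    proof -
      have False if "z \<in> M i #>\<^bsub>G\<^esub> x" "\<pi> z \<in> \<pi> ` (M i #>\<^bsub>G\<^esub> y)" for z
      proof -
        have zc: "z \<in> carrier G" using that(1) coset_sub xy by blast
        then have "z \<in> M i #>\<^bsub>G\<^esub> y" using that(2) \<pi>_coset xy by blast
        then have "M i #>\<^bsub>G\<^esub> x = M i #>\<^bsub>G\<^esub> y"
          using that(1) zc coset_iff coset_eq xy by metis
        then show False using i coset_eq xy by blast
      qed
      then show ?thesis by (auto simp: disjnt_iff)
    qed
    moreover have "p \<in> \<pi> ` (M i #>\<^bsub>G\<^esub> x)" "q \<in> \<pi> ` (M i #>\<^bsub>G\<^esub> y)"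
      using xy rcos_self normal_imp_subgroup[OF M] by auto
    ultimately show "\<exists>U V. openin Q U \<and> openin Q V \<and> p \<in> U \<and> q \<in> V \<and> disjnt U V"
      using opB[OF xy(1)] opB[OF xy(3)] by blast
  qed
  have compQ: "compact_space Q"
    using comp qm by (metis compact_space_def image_compactin quotient_imp_continuous_map quotient_imp_surjective_map)
  define \<B> where "\<B> = (\<Union>i. (\<lambda>A. \<pi> ` A) ` carrier (G Mod M i))"
  have c2: "second_countable Q"
    unfolding second_countable_def
  proof (intro exI[of _ \<B>] conjI strip)
    show "countable \<B>"
      unfolding \<B>_def using fin by (intro countable_UN) (auto intro: countable_finite)
    show "openin Q V" if "V \<in> \<B>" for V
      using that opB by (auto simp: \<B>_def carrier_FactGroup)
    fix W p assume W: "openin Q W \<and> p \<in> W"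
    then obtain x where x: "x \<in> carrier G" "p = \<pi> x"
      using openin_subset[of Q W] topQ by blast
    define P where "P = {y \<in> carrier G. \<pi> y \<in> W}"
    have P: "openin T P" using W by (simp add: opQ P_def)
    have anti: "i \<le> j \<Longrightarrow> M j \<subseteq> M i" for i j
      by (rule lift_Suc_antimono_le[of M]) (use dec in auto)
    \<comment> \<open>The cosets of the \<open>M i\<close> through \<open>x\<close> decrease to the
      fibre of \<open>\<pi>\<close> over \<open>p\<close>, which lies in \<open>P\<close>. Hence
      \<open>P\<close> and the complements \<open>Z i\<close> form an open cover, and compactness
      lets finitely many of them suffice.\<close>
    have "\<exists>i. M i #>\<^bsub>G\<^esub> x \<subseteq> P"
    proof -
      define Z where "Z = (\<lambda>i. carrier G - (M i #>\<^bsub>G\<^esub> x))"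
      have "openin T (Z i)" for i
        unfolding Z_def top[symmetric]
        using topological_group_coset(2)[OF tg M x(1) cl] by (simp add: openin_diff)
      then have "\<forall>U\<in>insert P (range Z). openin T U" using P by blast
      moreover have "topspace T \<subseteq> \<Union>(insert P (range Z))"
      proof
        fix y assume y: "y \<in> topspace T"
        show "y \<in> \<Union>(insert P (range Z))"
        proof (cases "\<forall>i. y \<in> M i #>\<^bsub>G\<^esub> x")
          case True
          then have "\<pi> y = p"
            using coset_iff rcos_eq_iff x y top by (auto simp: N_def \<pi>_def)
          then show ?thesis using W y top by (auto simp: P_def)
        qed (use y top in \<open>auto simp: Z_def\<close>)
      qed
      ultimately obtain \<F> where \<F>: "finite \<F>" "\<F> \<subseteq> insert P (range Z)" "topspace T \<subseteq> \<Union>\<F>"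
        using comp unfolding compact_space_alt by meson
      have "finite (\<F> - {P})" "\<F> - {P} \<subseteq> range Z" using \<F> by auto
      then obtain J where J: "finite J" "\<F> - {P} = Z ` J"
        by (metis finite_subset_image)
      \<comment> \<open>The coset of \<open>M k\<close> through \<open>x\<close> lies in all the
        cosets with index in \<open>J\<close>, so it avoids every \<open>Z j\<close> of the subcover
        and must lie in \<open>P\<close>. If \<open>J\<close> is empty, \<open>P\<close> alone
        covers.\<close>
      obtain k where k: "\<And>j. j \<in> J \<Longrightarrow> j \<le> k"
        using J(1) finite_nat_set_iff_bounded_le by auto
      have "M k #>\<^bsub>G\<^esub> x \<subseteq> P"
      proof
        fix y assume y: "y \<in> M k #>\<^bsub>G\<^esub> x"
        then have yc: "y \<in> carrier G" using coset_sub x by blast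
        have "y \<notin> Z j" if "j \<in> J" for j
          using y anti[OF k[OF that]] by (auto simp: Z_def r_coset_def)
        moreover have "y \<in> \<Union>\<F>" using \<F>(3) yc top by auto
        ultimately show "y \<in> P" using J(2) by blast
      qed
      then show ?thesis ..
    qed
    then obtain i where i: "M i #>\<^bsub>G\<^esub> x \<subseteq> P" ..
    have "\<pi> ` (M i #>\<^bsub>G\<^esub> x) \<in> \<B>"
      using x by (auto simp: \<B>_def carrier_FactGroup)
    moreover have "p \<in> \<pi> ` (M i #>\<^bsub>G\<^esub> x)"
      using x rcos_self normal_imp_subgroup[OF M] by auto
    moreover have "\<pi> ` (M i #>\<^bsub>G\<^esub> x) \<subseteq> W" using i by (auto simp: P_def)
    ultimately show "\<exists>V\<in>\<B>. p \<in> V \<and> V \<subseteq> W" by blast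
  qed
  have "regular_space Q"
    using compQ haus by (rule compact_Hausdorff_imp_regular_space)
  then have "metrizable_space Q"
    using haus c2 by (rule regular_second_countable_imp_metrizable_space)
  moreover have "separable_space Q"
    using c2 by (rule second_countable_imp_separable_space)
  ultimately show "separable_space (quotient_topology G T (\<Inter>i. M i))"
    "metrizable_space (quotient_topology G T (\<Inter>i. M i))"
    by (simp_all add: Q_def N_def)
qed

section \<open>Case distinction on the existence of an infinite Lie quotient\<close>

theorem theorem2p14:
  fixes G :: "('a, 'b) monoid_scheme" and T :: "'a topology"
  assumes "pro_Lie_group G T"
    and "sigma_compact_space T"
    and "infinite (carrier G)"
  shows "\<exists>N. N \<lhd> G \<and> closedin T N \<and>
           infinite (carrier (G Mod N)) \<and>
           separable_space (quotient_topology G T N) \<and>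
           metrizable_space (quotient_topology G T N)"
proof (cases "\<exists>N. N \<lhd> G \<and> closedin T N \<and> Lie_group (G Mod N) (quotient_topology G T N) \<and>
    infinite (carrier (G Mod N))")
  have tg: "topological_group G T"
    using assms(1) by (simp add: pro_Lie_group_def)
  then have top: "topspace T = carrier G" and haus: "Hausdorff_space T"
    by (simp_all add: topological_group_def)
  interpret group G using tg by (simp add: topological_group_def)
  {
    case True
    then obtain N where N: "N \<lhd> G" "closedin T N" "Lie_group (G Mod N) (quotient_topology G T N)"
      "infinite (carrier (G Mod N))" by blast
    have q: "quotient_map T (quotient_topology G T N) (\<lambda>x. N #>\<^bsub>G\<^esub> x)"
      by (rule quotient_map_quotient_topology[OF top])
    have "sigma_compact_space (quotient_topology G T N)"
      by (rule sigma_compact_space_continuous_map_image[OF assms(2)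
            quotient_imp_continuous_map[OF q] quotient_imp_surjective_map[OF q]])
    then show ?thesis
      using N sigma_compact_Lie_group_separable_metrizable by blast
  next
    case False
    \<comment> \<open>In this case every Lie quotient is finite, so the subgroups supplied by the
      pro-Lie condition are open as well as closed.\<close>
    define good where "good N \<longleftrightarrow> N \<lhd> G \<and> closedin T N \<and> openin T N \<and> finite (carrier (G Mod N))" for N
    have nbhd: "\<exists>N. good N \<and> N \<subseteq> U" if U: "openin T U" "\<one>\<^bsub>G\<^esub> \<in> U" for U
    proof -
      obtain N where N: "N \<lhd> G" "closedin T N" "N \<subseteq> U" "Lie_group (G Mod N) (quotient_topology G T N)"
        using assms(1) U unfolding pro_Lie_group_def by meson
      then have "finite (carrier (G Mod N))" using False by blast
      moreover have "Hausdorff_space (quotient_topology G T N)"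
        using N(4) by (simp add: Lie_group_def topological_group_def)
      ultimately have "good N"
        using N openin_if_finite_Hausdorff_quotient[OF top N(1)] by (simp add: good_def)
      then show ?thesis using N(3) by blast
    qed
    have compact: "compact_space T"
    proof (rule finite_quotients_complete_imp_compact_space[OF _ is_group top])
      show "complete_group G T" using assms(1) by (simp add: pro_Lie_group_def)
      show "\<exists>N. N \<lhd> G \<and> N \<subseteq> U \<and> finite (carrier (G Mod N))"
        if "openin T U" "\<one>\<^bsub>G\<^esub> \<in> U" for U
        using nbhd[OF that] by (auto simp: good_def)
    qed
    \<comment> \<open>Dependent choice builds the sequence: a good \<open>N\<close> is shrunk by
      removing a point \<open>x\<close> other than the identity and taking a good subgroup inside
      the open set that remains.\<close>
    have "\<exists>M. \<forall>i::nat. good (M i) \<and> M (Suc i) \<subset> M i"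
    proof (rule dependent_nat_choice)
      show "\<exists>N. good N" using nbhd[OF openin_topspace] top by auto
      fix N and i :: nat assume N: "good N"
      interpret N: normal N G using N by (simp add: good_def)
      \<comment> \<open>A finite \<open>N\<close> of finite index would make \<open>G\<close>
        finite. Infinitude provides the point \<open>x\<close> to remove.\<close>
      have "infinite N"
      proof
        assume "finite N"
        then have "finite A" if "A \<in> rcosets\<^bsub>G\<^esub> N" for A
          using that by (auto simp: RCOSETS_def r_coset_def)
        then have "finite (\<Union>(rcosets\<^bsub>G\<^esub> N))"
          using N by (intro finite_Union) (auto simp: good_def FactGroup_def)
        then show False
          using assms(3) rcosets_part_G[OF N.is_subgroup] by simp
      qed
      then have "\<not> N \<subseteq> {\<one>\<^bsub>G\<^esub>}"
        using finite_subset by blast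
      then obtain x where x: "x \<in> N" "x \<noteq> \<one>\<^bsub>G\<^esub>"
        by blast
      have "closedin T {x}"
        using haus x(1) N.subset top by (auto simp: closedin_Hausdorff_sing_eq)
      then have "openin T (N - {x})" "\<one>\<^bsub>G\<^esub> \<in> N - {x}"
        using N x by (auto simp: good_def openin_diff)
      then obtain N' where "good N'" "N' \<subseteq> N - {x}" using nbhd by blast
      then show "\<exists>N'. good N' \<and> N' \<subset> N" using x by blast
    qed
    then obtain M where "\<forall>i::nat. good (M i) \<and> M (Suc i) \<subset> M i" by (elim exE)
    then have M: "good (M i)" "M (Suc i) \<subset> M i" for i by simp_all
    have Mn: "M i \<lhd> G" for i using M(1) by (simp add: good_def)
    have N: "(\<Inter>i. M i) \<lhd> G" by (rule normal_Inter_seq[OF Mn])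
    have "closedin T (\<Inter>i. M i)"
      using M(1) by (intro closedin_Inter) (auto simp: good_def)
    then show ?thesis
      using N infinite_quotient_by_decreasing_Inter[OF N Mn M(2)]
        compact_quotient_by_decreasing_Inter_separable_metrizable[OF tg compact N Mn] M
      by (intro exI[of _ "\<Inter>i. M i"]) (auto simp: good_def psubset_imp_subset)
  }
qed

end
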